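(* Let $r\ge 2$, let $\alpha_1,\dots,\alpha_r,\beta_1,\dots,\beta_r,\gamma>-1$ be real numbers with $(\alpha_i,\beta_i)\neq(\alpha_j,\beta_j)$ for $i\ne j$, and let $0\le k_j\le n_j$ ($j=1,\dots,r$) be integers. Then the function $$U^{(\vec\alpha,\vec\beta,\gamma)}_{\vec n,\vec k}(x,y)=D_r\circ\cdots\circ D_1\big[(1-x-y)^{n_1+\cdots+n_r}\big]$$ is a polynomial in $x,y$ of total degree exactly $|\vec n|=n_1+\cdots+n_r$.
   Context: Let $T=\{(x,y)\in\mathbb R^2: x\ge 0,\ y\ge 0,\ x+y\le 1\}$ and $W_j(x,y)=x^{\alpha_j}y^{\beta_j}(1-x-y)^{\gamma}$ for $j=1,\dots,r$. For integers $0\le k_j\le n_j$ and a smooth function $f$, the operator $D_j$ is $$D_j[f(x,y)]=\frac{1}{W_j(x,y)}\,\frac{\partial^{n_j}}{\partial x^{n_j-k_j}\,\partial y^{k_j}}\Big(W_j(x,y)\,x^{n_j-k_j}y^{k_j}f(x,y)\Big).$$ All these expressions are taken on the interior of $T$ (where $W_j$ is smooth and positive); "is a polynomial" means that the function coincides there with a polynomial. Notation: $\vec n=(n_1,\dots,n_r)$, $\vec k=(k_1,\dots,k_r)$, $\vec\alpha=(\alpha_1,\dots,\alpha_r)$, $\vec\beta=(\beta_1,\dots,\beta_r)$. *)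

theory Defs
  imports "HOL-Analysis.Analysis" "HOL-Computational_Algebra.Polynomial"
begin

definition unit_triangle :: "(real \<times> real) set" where
  "unit_triangle = {(x, y). x \<ge> 0 \<and> y \<ge> 0 \<and> x + y \<le> 1}"

definition weight :: "real \<Rightarrow> real \<Rightarrow> real \<Rightarrow> real \<Rightarrow> real \<Rightarrow> real" where
  "weight \<alpha> \<beta> \<gamma> x y = x powr \<alpha> * y powr \<beta> * (1 - x - y) powr \<gamma>"

(* deriv is local, so at points of the open set interior unit_triangle the iterated
   partial derivatives below do not depend on the values of the functions
   (in particular of powr) outside that set. *)

definition partial_x :: "(real \<Rightarrow> real \<Rightarrow> real) \<Rightarrow> real \<Rightarrow> real \<Rightarrow> real" where
  "partial_x f x y = deriv (\<lambda>t. f t y) x"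

definition partial_y :: "(real \<Rightarrow> real \<Rightarrow> real) \<Rightarrow> real \<Rightarrow> real \<Rightarrow> real" where
  "partial_y f x y = deriv (\<lambda>t. f x t) y"

definition D_op :: "real \<Rightarrow> real \<Rightarrow> real \<Rightarrow> nat \<Rightarrow> nat \<Rightarrow>
    (real \<Rightarrow> real \<Rightarrow> real) \<Rightarrow> real \<Rightarrow> real \<Rightarrow> real" where
  "D_op \<alpha> \<beta> \<gamma> n k f x y =
     1 / weight \<alpha> \<beta> \<gamma> x y *
     (partial_x ^^ (n - k)) ((partial_y ^^ k)
       (\<lambda>x y. weight \<alpha> \<beta> \<gamma> x y * x ^ (n - k) * y ^ k * f x y)) x y"

(* fold applies the operator with index 1 first and the one with index r last. *)
definition U :: "nat \<Rightarrow> (nat \<Rightarrow> real) \<Rightarrow> (nat \<Rightarrow> real) \<Rightarrow> real \<Rightarrow> (nat \<Rightarrow> nat) \<Rightarrow> (nat \<Rightarrow> nat) \<Rightarrow>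
    real \<Rightarrow> real \<Rightarrow> real" where
  "U r \<alpha> \<beta> \<gamma> n k =
     fold (\<lambda>j. D_op (\<alpha> j) (\<beta> j) \<gamma> (n j) (k j)) [1..<Suc r]
       (\<lambda>x y. (1 - x - y) ^ (\<Sum>j=1..r. n j))"

(* Bivariate polynomials are elements of 'a poly poly: the coefficient of x^i y^j
   in p is coeff (coeff p i) j. *)

definition poly2 :: "'a::comm_semiring_1 poly poly \<Rightarrow> 'a \<Rightarrow> 'a \<Rightarrow> 'a" where
  "poly2 p x y = poly (poly p [:x:]) y"

(* Meaningful only for p \<noteq> 0; the zero polynomial has to be excluded separately. *)
definition total_degree :: "'a::zero poly poly \<Rightarrow> nat" where
  "total_degree p = Max {i + j | i j. coeff (coeff p i) j \<noteq> 0}"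

end

theory Submission
  imports Defs
begin

text \<open>
  Put \<open>z = 1 - x - y\<close>. A partial derivative of \<open>x\<^sup>a y\<^sup>b z\<^sup>c p(x, y)\<close> has the same shape: the
  exponents \<open>b, c\<close> (for the \<open>y\<close>-derivative) or \<open>a, c\<close> (for the \<open>x\<close>-derivative) drop by one, and
  the degree of the polynomial factor grows by at most one. Hence after \<open>D\<^sub>1, \<dots>, D\<^sub>j\<close> the function
  is \<open>z\<close> to the power \<open>n\<^sub>j\<^sub>+\<^sub>1 + \<dots> + n\<^sub>r\<close> times a polynomial of degree at most
  \<open>n\<^sub>1 + \<dots> + n\<^sub>j\<close>. To see that the degree is exact, one follows the coefficient of the pure power
  of \<open>x\<close> of top degree \<open>d\<close>: a \<open>y\<close>-derivative multiplies it by \<open>-b\<close> and an \<open>x\<close>-derivative by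
  \<open>-(a + c + d)\<close>, and none of these factors vanishes.
\<close>

section \<open>Evaluation and partial derivatives of bivariate polynomials\<close>

lemma poly2_pCons [simp]: "poly2 (pCons q p) x y = poly q y + x * poly2 p x y"
  for x y :: "'a::comm_ring_1"
  by (simp add: poly2_def)

lemma poly2_0 [simp]: "poly2 0 x y = 0"
  by (simp add: poly2_def)

lemma poly2_add [simp]: "poly2 (p + q) x y = poly2 p x y + poly2 q x y"
  by (simp add: poly2_def)

lemma poly2_diff [simp]: "poly2 (p - q) x y = poly2 p x y - poly2 q x y"
  for x y :: "'a::comm_ring_1"
  by (simp add: poly2_def)

lemma poly2_smult [simp]: "poly2 (smult c p) x y = poly c y * poly2 p x y"
  by (simp add: poly2_def)

lemma map_poly_pderiv_pCons [simp]:
  "map_poly pderiv (pCons q p) = pCons (pderiv q) (map_poly pderiv p)"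
  by (rule map_poly_pCons) simp

lemma DERIV_poly2_y:
  fixes x y :: real
  shows "((\<lambda>t. poly2 p x t) has_real_derivative poly2 (map_poly pderiv p) x y) (at y)"
proof (induction p)
  case (pCons q p)
  show ?case
    by (auto intro!: derivative_eq_intros pCons.IH poly_DERIV)
qed simp

lemma DERIV_poly2_x:
  fixes x y :: real
  shows "((\<lambda>t. poly2 p t y) has_real_derivative poly2 (pderiv p) x y) (at x)"
proof (induction p)
  case (pCons q p)
  show ?case
    by (auto intro!: derivative_eq_intros pCons.IH simp: pderiv_pCons)
qed simp

section \<open>The action of a derivative on the polynomial factor\<close>

definition mult_z :: "real poly poly \<Rightarrow> real poly poly" where
  "mult_z p = p - pCons 0 p - smult [:0, 1:] p"

lemma poly2_mult_z [simp]: "poly2 (mult_z p) x y = (1 - x - y) * poly2 p x y"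
  by (simp add: mult_z_def algebra_simps)

text \<open>With \<open>z = 1 - x - y\<close>, this is \<open>b z p - c y p + y z p_y\<close>: what
  remains of the y-derivative of \<open>x^a y^b z^c p\<close> once
  \<open>x^a y^(b-1) z^(c-1)\<close> is taken out.\<close>

definition deriv_step_y :: "real \<Rightarrow> real \<Rightarrow> real poly poly \<Rightarrow> real poly poly" where
  "deriv_step_y b c p = smult [:b:] (mult_z p) - smult [:c:] (smult [:0, 1:] p)
     + mult_z (smult [:0, 1:] (map_poly pderiv p))"

definition deriv_step_x :: "real \<Rightarrow> real \<Rightarrow> real poly poly \<Rightarrow> real poly poly" where
  "deriv_step_x a c p = smult [:a:] (mult_z p) - smult [:c:] (pCons 0 p)
     + mult_z (pCons 0 (pderiv p))"

text \<open>Stronger than having total degree \<open>d\<close>, and chosen because it propagates: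
  after a derivative step the coefficient of \<open>x^(d+1)\<close> depends on that of
  \<open>x^d\<close> alone.\<close>

definition x_leading :: "nat \<Rightarrow> real poly poly \<Rightarrow> bool" where
  "x_leading d p \<longleftrightarrow> (\<forall>i j. d < i + j \<longrightarrow> coeff (coeff p i) j = 0) \<and> coeff (coeff p d) 0 \<noteq> 0"

lemma x_leading_nonzero: "x_leading d p \<Longrightarrow> p \<noteq> 0"
  by (auto simp: x_leading_def)

lemma total_degree_x_leading:
  assumes "x_leading d p"
  shows "total_degree p = d"
proof -
  let ?S = "{i + j | i j. coeff (coeff p i) j \<noteq> 0}"
  have le: "s \<le> d" if "s \<in> ?S" for s
    using that assms by (auto simp: x_leading_def) (meson not_le)
  then have "finite ?S"
    by (meson finite_nat_set_iff_bounded_le)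
  moreover have "d \<in> ?S"
    using assms by (force simp: x_leading_def)
  ultimately show ?thesis
    unfolding total_degree_def using le by (intro Max_eqI) auto
qed

lemma coeff_deriv_step_y:
  "coeff (coeff (deriv_step_y b c p) i) j =
     (b + j) * (coeff (coeff p i) j - (if i = 0 then 0 else coeff (coeff p (i - 1)) j))
     - (if j = 0 then 0 else (b + c + j - 1) * coeff (coeff p i) (j - 1))"
  by (cases i; cases j)
     (auto simp: deriv_step_y_def mult_z_def coeff_map_poly coeff_pderiv coeff_pCons algebra_simps
       split: nat.splits)

lemma coeff_deriv_step_x:
  "coeff (coeff (deriv_step_x a c p) i) j =
     (a + i) * (coeff (coeff p i) j - (if j = 0 then 0 else coeff (coeff p i) (j - 1)))
     - (if i = 0 then 0 else (a + c + i - 1) * coeff (coeff p (i - 1)) j)"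
  by (cases i; cases j)
     (auto simp: deriv_step_x_def mult_z_def coeff_pderiv coeff_pCons of_nat_poly algebra_simps
       split: nat.splits)

text \<open>At \<open>i = Suc d\<close>, \<open>j = 0\<close> the last term of the coefficient
  formula is absent and \<open>p\<close> has no \<open>x^(d+1)\<close>, so \<open>-b\<close> times
  the old leading coefficient is left.\<close>

lemma x_leading_deriv_step_y:
  assumes "x_leading d p" "b \<noteq> 0"
  shows "x_leading (Suc d) (deriv_step_y b c p)"
  using assms unfolding x_leading_def by (auto simp: coeff_deriv_step_y)

lemma x_leading_deriv_step_x:
  assumes "x_leading d p" "a + c + real d \<noteq> 0"
  shows "x_leading (Suc d) (deriv_step_x a c p)"
  using assms unfolding x_leading_def by (auto simp: coeff_deriv_step_x)

section \<open>Differentiating weighted polynomials inside the triangle\<close>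

lemma interior_unit_triangle_pos:
  assumes "(x, y) \<in> interior unit_triangle"
  shows "0 < x" "0 < y" "0 < 1 - x - y"
proof -
  obtain e where e: "e > 0" "ball (x, y) e \<subseteq> unit_triangle"
    using assms by (auto simp: mem_interior)
  \<comment> \<open>Shifts to the left, downwards and to the right make the three weak inequalities
    of the triangle strict.\<close>
  have "(x - e/2, y) \<in> ball (x, y) e" "(x, y - e/2) \<in> ball (x, y) e" "(x + e/2, y) \<in> ball (x, y) e"
    using e by (auto simp: dist_Pair_Pair dist_real_def)
  with e(2) have "(x - e/2, y) \<in> unit_triangle" "(x, y - e/2) \<in> unit_triangle"
    "(x + e/2, y) \<in> unit_triangle"
    by blast+
  with e(1) show "0 < x" "0 < y" "0 < 1 - x - y"
    by (auto simp: unit_triangle_def)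
qed

text \<open>Equality is asked only on the interior; this set is open, so the formula may still be
  differentiated.\<close>

definition weighted_poly ::
    "real \<Rightarrow> real \<Rightarrow> real \<Rightarrow> real poly poly \<Rightarrow> (real \<Rightarrow> real \<Rightarrow> real) \<Rightarrow> bool" where
  "weighted_poly a b c p f \<longleftrightarrow>
     (\<forall>(x, y) \<in> interior unit_triangle. f x y = weight a b c x y * poly2 p x y)"

text \<open>Allows \<open>deriv_cong_ev\<close> to replace a function by its formula along the
  vertical line through the point.\<close>

lemma eventually_slice_y:
  assumes "(x, y) \<in> interior unit_triangle"
  shows "\<forall>\<^sub>F t in nhds y. (x, t) \<in> interior unit_triangle"
proof -
  have "open ((\<lambda>t. (x, t)) -` interior unit_triangle)"
    by (intro open_vimage continuous_intros) auto
  then show ?thesis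
    using assms by (auto simp: eventually_nhds intro!: exI[of _ "(\<lambda>t. (x, t)) -` interior unit_triangle"])
qed

lemma eventually_slice_x:
  assumes "(x, y) \<in> interior unit_triangle"
  shows "\<forall>\<^sub>F t in nhds x. (t, y) \<in> interior unit_triangle"
proof -
  have "open ((\<lambda>t. (t, y)) -` interior unit_triangle)"
    by (intro open_vimage continuous_intros) auto
  then show ?thesis
    using assms by (auto simp: eventually_nhds intro!: exI[of _ "(\<lambda>t. (t, y)) -` interior unit_triangle"])
qed

lemma powr_minus_one_cancel: "0 < t \<Longrightarrow> t powr a = t * t powr (a - 1)" for t a :: real
  by (simp add: powr_diff)

lemma weighted_poly_partial_y:
  assumes "weighted_poly a b c p f"
  shows "weighted_poly a (b - 1) (c - 1) (deriv_step_y b c p) (partial_y f)"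
  unfolding weighted_poly_def
proof clarify
  fix x y assume xy: "(x, y) \<in> interior unit_triangle"
  note pos = interior_unit_triangle_pos[OF xy]
  have "partial_y f x y = deriv (\<lambda>t. weight a b c x t * poly2 p x t) y"
    unfolding partial_y_def
    using eventually_slice_y[OF xy] assms
    by (intro deriv_cong_ev) (auto elim!: eventually_mono simp: weighted_poly_def)
  also have "\<dots> = x powr a * ((b * y powr (b - 1) * (1 - x - y) powr c
      - y powr b * (c * (1 - x - y) powr (c - 1))) * poly2 p x y
      + y powr b * (1 - x - y) powr c * poly2 (map_poly pderiv p) x y)"
    unfolding weight_def using pos
    by (intro DERIV_imp_deriv)
       (auto intro!: derivative_eq_intros has_real_derivative_powr DERIV_poly2_y
         DERIV_chain2[where f = "\<lambda>t. t powr c" and g = "\<lambda>t. 1 - x - t"] simp: algebra_simps)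
  also have "\<dots> = weight a (b - 1) (c - 1) x y * poly2 (deriv_step_y b c p) x y"
    \<comment> \<open>Splitting one factor off \<open>y powr b\<close> and off
      \<open>z powr c\<close> exposes the common weight with exponents \<open>b - 1\<close> and
      \<open>c - 1\<close>.\<close>
    using powr_minus_one_cancel[OF pos(2), of b] powr_minus_one_cancel[OF pos(3), of c]
    by (simp add: weight_def deriv_step_y_def del: mult_cancel_left mult_cancel_right)
       (simp add: algebra_simps)
  finally show "partial_y f x y =
      weight a (b - 1) (c - 1) x y * poly2 (deriv_step_y b c p) x y" .
qed

lemma weighted_poly_partial_x:
  assumes "weighted_poly a b c p f"
  shows "weighted_poly (a - 1) b (c - 1) (deriv_step_x a c p) (partial_x f)"
  unfolding weighted_poly_def
proof clarify
  fix x y assume xy: "(x, y) \<in> interior unit_triangle"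
  note pos = interior_unit_triangle_pos[OF xy]
  have "partial_x f x y = deriv (\<lambda>t. weight a b c t y * poly2 p t y) x"
    unfolding partial_x_def
    using eventually_slice_x[OF xy] assms
    by (intro deriv_cong_ev) (auto elim!: eventually_mono simp: weighted_poly_def)
  also have "\<dots> = y powr b * ((a * x powr (a - 1) * (1 - x - y) powr c
      - x powr a * (c * (1 - x - y) powr (c - 1))) * poly2 p x y
      + x powr a * (1 - x - y) powr c * poly2 (pderiv p) x y)"
    unfolding weight_def using pos
    by (intro DERIV_imp_deriv)
       (auto intro!: derivative_eq_intros has_real_derivative_powr DERIV_poly2_x
         DERIV_chain2[where f = "\<lambda>t. t powr c" and g = "\<lambda>t. 1 - t - y"] simp: algebra_simps)
  also have "\<dots> = weight (a - 1) b (c - 1) x y * poly2 (deriv_step_x a c p) x y"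
    using powr_minus_one_cancel[OF pos(1), of a] powr_minus_one_cancel[OF pos(3), of c]
    by (simp add: weight_def deriv_step_x_def del: mult_cancel_left mult_cancel_right)
       (simp add: algebra_simps)
  finally show "partial_x f x y =
      weight (a - 1) b (c - 1) x y * poly2 (deriv_step_x a c p) x y" .
qed

section \<open>Iterated derivatives and the operator \<open>D_op\<close>\<close>

lemma weighted_poly_funpow_partial_y:
  assumes "weighted_poly a b c p f" "x_leading d p" "b > real k - 1"
  shows "\<exists>q. weighted_poly a (b - k) (c - k) q ((partial_y ^^ k) f) \<and> x_leading (d + k) q"
  using assms(3)
proof (induction k)
  case 0
  show ?case using assms(1,2) by auto
next
  case (Suc k)
  then obtain q where q: "weighted_poly a (b - k) (c - k) q ((partial_y ^^ k) f)"
    "x_leading (d + k) q"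
    by auto
  \<comment> \<open>The factor met here is \<open>b - k\<close>, which is positive because
    \<open>b > Suc k - 1\<close>.\<close>
  show ?case
    using weighted_poly_partial_y[OF q(1)] x_leading_deriv_step_y[OF q(2), of "b - k" "c - k"]
      Suc.prems
    by (auto simp: algebra_simps)
qed

text \<open>Each step lowers \<open>a\<close> and \<open>c\<close> by one and raises
  \<open>d\<close> by one, so the factor \<open>a + c + d\<close> drops by one per step and stays
  positive. For \<open>k = 0\<close> no factor occurs.\<close>

lemma weighted_poly_funpow_partial_x:
  assumes "weighted_poly a b c p f" "x_leading d p" "k = 0 \<or> a + c + real d > real k - 1"
  shows "\<exists>q. weighted_poly (a - k) b (c - k) q ((partial_x ^^ k) f) \<and> x_leading (d + k) q"
  using assms(3)
proof (induction k)
  case 0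
  show ?case using assms(1,2) by auto
next
  case (Suc k)
  then obtain q where q: "weighted_poly (a - k) b (c - k) q ((partial_x ^^ k) f)"
    "x_leading (d + k) q"
    by auto
  show ?case
    using weighted_poly_partial_x[OF q(1)] x_leading_deriv_step_x[OF q(2), of "a - k" "c - k"]
      Suc.prems
    by (auto simp: algebra_simps)
qed

text \<open>The weight and the monomial give exponents \<open>\<alpha> + n - k\<close>,
  \<open>\<beta> + k\<close>, \<open>\<gamma> + m\<close>. The derivatives lower them to
  \<open>\<alpha>\<close>, \<open>\<beta>\<close>, \<open>\<gamma> + m - n\<close>, and division by
  the weight leaves \<open>z^(m-n)\<close>.\<close>

lemma weighted_poly_D_op:
  assumes f: "weighted_poly 0 0 (real m) p f" "x_leading d p"
    and "\<alpha> > -1" "\<beta> > -1" "\<gamma> > -1" "k \<le> n" "n \<le> m"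
  shows "\<exists>q. weighted_poly 0 0 (real (m - n)) q (D_op \<alpha> \<beta> \<gamma> n k f) \<and> x_leading (d + n) q"
proof -
  let ?g = "\<lambda>x y. weight \<alpha> \<beta> \<gamma> x y * x ^ (n - k) * y ^ k * f x y"
  have "weighted_poly (\<alpha> + real (n - k)) (\<beta> + k) (\<gamma> + m) p ?g"
    unfolding weighted_poly_def
  proof clarify
    fix x y assume xy: "(x, y) \<in> interior unit_triangle"
    note pos = interior_unit_triangle_pos[OF xy]
    \<comment> \<open>Positivity matters: \<open>x powr 0\<close> is 1 for positive
      \<open>x\<close>, but 0 at \<open>x = 0\<close>.\<close>
    have "f x y = (1 - x - y) powr m * poly2 p x y"
      using f(1) xy pos by (auto simp: weighted_poly_def weight_def)
    then show "?g x y = weight (\<alpha> + real (n - k)) (\<beta> + k) (\<gamma> + m) x y * poly2 p x y"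
      using pos by (simp only: weight_def powr_add powr_realpow mult_ac)
  qed
  from weighted_poly_funpow_partial_y[OF this f(2), of k]
  obtain q where q: "weighted_poly (\<alpha> + real (n - k)) \<beta> (\<gamma> + m - k) q ((partial_y ^^ k) ?g)"
    "x_leading (d + k) q"
    using assms by auto
  \<comment> \<open>If \<open>k < n\<close> then \<open>m \<ge> n \<ge> 1\<close>, hence
    \<open>\<alpha> + \<gamma> + m > -1\<close>. For \<open>n = k = m = d = 0\<close> the inequality
    itself can fail.\<close>
  have "n - k = 0 \<or> \<alpha> + real (n - k) + (\<gamma> + m - k) + real (d + k) > real (n - k) - 1"
    using assms by (cases "n = k") auto
  from weighted_poly_funpow_partial_x[OF q this]
  obtain q' where q': "weighted_poly \<alpha> \<beta> (\<gamma> + m - k - real (n - k)) q'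
      ((partial_x ^^ (n - k)) ((partial_y ^^ k) ?g))" "x_leading (d + n) q'"
    using assms by (auto simp: add.assoc)
  have exponent: "\<gamma> + m - k - real (n - k) = \<gamma> + real (m - n)"
    using assms by simp
  have "weighted_poly 0 0 (real (m - n)) q' (D_op \<alpha> \<beta> \<gamma> n k f)"
    unfolding weighted_poly_def
  proof clarify
    fix x y assume xy: "(x, y) \<in> interior unit_triangle"
    note pos = interior_unit_triangle_pos[OF xy]
    have "(partial_x ^^ (n - k)) ((partial_y ^^ k) ?g) x y =
        weight \<alpha> \<beta> (\<gamma> + real (m - n)) x y * poly2 q' x y"
      using q'(1) xy by (auto simp: weighted_poly_def exponent)
    then show "D_op \<alpha> \<beta> \<gamma> n k f x y = weight 0 0 (real (m - n)) x y * poly2 q' x y"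
      using pos by (simp add: D_op_def weight_def powr_add)
  qed
  with q'(2) show ?thesis by blast
qed

theorem proposition3p4:
  fixes r :: nat and \<alpha> \<beta> :: "nat \<Rightarrow> real" and \<gamma> :: real and n k :: "nat \<Rightarrow> nat"
  assumes "r \<ge> 2"
    and "\<And>j. j \<in> {1..r} \<Longrightarrow> \<alpha> j > -1"
    and "\<And>j. j \<in> {1..r} \<Longrightarrow> \<beta> j > -1"
    and "\<gamma> > -1"
    and "\<And>i j. i \<in> {1..r} \<Longrightarrow> j \<in> {1..r} \<Longrightarrow> i \<noteq> j \<Longrightarrow> (\<alpha> i, \<beta> i) \<noteq> (\<alpha> j, \<beta> j)"
    and "\<And>j. j \<in> {1..r} \<Longrightarrow> k j \<le> n j"
  shows "\<exists>p :: real poly poly. p \<noteq> 0 \<and> total_degree p = (\<Sum>j=1..r. n j) \<and>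
           (\<forall>(x, y) \<in> interior unit_triangle. U r \<alpha> \<beta> \<gamma> n k x y = poly2 p x y)"
proof -
  define N where "N = (\<Sum>j=1..r. n j)"
  \<comment> \<open>The first \<open>s\<close> operators act on the full power \<open>z^N\<close>,
    so that \<open>N - M s\<close> factors \<open>z\<close> remain for the later ones.\<close>
  define F where "F s = fold (\<lambda>j. D_op (\<alpha> j) (\<beta> j) \<gamma> (n j) (k j)) [1..<Suc s]
    (\<lambda>x y. (1 - x - y) ^ N)" for s
  define M where "M s = (\<Sum>j=1..s. n j)" for s
  have "\<exists>p. weighted_poly 0 0 (real (N - M s)) p (F s) \<and> x_leading (M s) p" if "s \<le> r" for s
    using that
  proof (induction s)
    case 0
    have "weighted_poly 0 0 (real N) [:[:1:]:] (\<lambda>x y. (1 - x - y) ^ N)"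
      using interior_unit_triangle_pos by (force simp: weighted_poly_def weight_def powr_realpow)
    moreover have "x_leading 0 [:[:1:]:]"
      by (auto simp: x_leading_def coeff_pCons split: nat.splits)
    ultimately show ?case
      by (auto simp: F_def M_def)
  next
    case (Suc s)
    then obtain p where p: "weighted_poly 0 0 (real (N - M s)) p (F s)" "x_leading (M s) p"
      by auto
    \<comment> \<open>Enough factors \<open>z\<close> are left for the next operator, and the
      natural subtraction \<open>N - M s\<close> is not truncated.\<close>
    have "M (Suc s) \<le> N"
      unfolding M_def N_def using Suc.prems by (intro sum_mono2) auto
    then have "n (Suc s) \<le> N - M s"
      by (simp add: M_def)
    from weighted_poly_D_op[OF p _ _ assms(4) _ this, of "\<alpha> (Suc s)" "\<beta> (Suc s)" "k (Suc s)"]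
    show ?case
      using assms(2,3,6)[of "Suc s"] Suc.prems by (auto simp: F_def M_def)
  qed
  from this[of r] obtain p where p: "weighted_poly 0 0 0 p (F r)" "x_leading N p"
    by (auto simp: M_def N_def)
  have "U r \<alpha> \<beta> \<gamma> n k x y = poly2 p x y" if "(x, y) \<in> interior unit_triangle" for x y
    using p(1) that interior_unit_triangle_pos[OF that]
    by (auto simp: weighted_poly_def weight_def U_def F_def N_def)
  with x_leading_nonzero[OF p(2)] total_degree_x_leading[OF p(2)] show ?thesis
    unfolding N_def by blast
qed

end
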